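(* Let $f:\mathbb{R}^n\to\mathbb{R}$ be locally Lipschitz and definable in some o-minimal structure on $(\mathbb{R},+,\cdot)$. Then $f$ is directed subdifferentiable at every $x\in\mathbb{R}^n$.
   Context: o-minimal structures. An o-minimal structure on $(\mathbb{R},+,\cdot)$ is a sequence $\mathcal{O}=\{\mathcal{O}_n\}_{n\in\mathbb{N}}$, where $\mathcal{O}_n$ is a Boolean algebra of subsets of $\mathbb{R}^n$ (called definable), such that for each $n$: (i) if $A\in\mathcal{O}_n$, then $A\times\mathbb{R},\ \mathbb{R}\times A\in\mathcal{O}_{n+1}$; (ii) if $\Pi:\mathbb{R}^{n+1}\to\mathbb{R}^n$ is the canonical projection and $A\in\mathcal{O}_{n+1}$, then $\Pi(A)\in\mathcal{O}_n$; (iii) $\mathcal{O}_n$ contains all sets $\{x\in\mathbb{R}^n: p(x)=0\}$ with $p:\mathbb{R}^n\to\mathbb{R}$ polynomial; (iv) $\mathcal{O}_1$ consists exactly of the finite unions of intervals and points. A function $f:S\subset\mathbb{R}^n\to\mathbb{R}^m$ is definable in $\mathcal{O}$ iff its graph, as a subset of $\mathbb{R}^n\times\mathbb{R}^m$, is definable in $\mathcal{O}$. Notation. $S_{n-1}$ is the Euclidean unit sphere of $\mathbb{R}^n$. The (Dini) directional derivative is $f'(x;l):=\lim_{t\downarrow0}\frac{f(x+tl)-f(x)}{t}$. For every $n\ge2$ and $l\in S_{n-1}$ a rotation matrix $R_{n,l}$ of $\mathbb{R}^n$ is fixed once and for all with $R_{n,l}(l)=e^n$ and $R_{n,l}(\mathrm{span}\{l\}^\perp)=\mathrm{span}\{e^1,\dots,e^{n-1}\}$.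 Let $\pi_{n-1,n}(x_1,\dots,x_n)=(x_1,\dots,x_{n-1})$ and $\Pi_{n-1,l}:=\pi_{n-1,n}R_{n,l}$. Its transpose $\Pi_{n-1,l}^{\top}=R_{n,l}^{-1}\pi_{n-1,n}^{\top}$ maps $\mathbb{R}^{n-1}$ onto $\mathrm{span}\{l\}^\perp$. Directed subdifferentiable functions (recursive definition). Let $M\ge0$. A function $f:\mathbb{R}\to\mathbb{R}$ is $M$-directed subdifferentiable at $x\in\mathbb{R}$ iff both one-sided directional derivatives $f'(x;-1),f'(x;1)$ exist and $\max\{|f'(x;-1)|,|f'(x;1)|\}\le M$. A function $f:\mathbb{R}^n\to\mathbb{R}$, $n\ge2$, is $M$-directed subdifferentiable at $x\in\mathbb{R}^n$ iff $f'(x;l)$ exists for every $l$, is continuous as a function of $l$, satisfies $\max_{l\in S_{n-1}}|f'(x;l)|\le M$, and for every $l\in S_{n-1}$ the function $f_l(\cdot)=f'(x;\,l+\Pi_{n-1,l}^{\top}(\cdot)):\mathbb{R}^{n-1}\to\mathbb{R}$ is $M$-directed subdifferentiable at $0_{n-1}$. The function $f$ is directed subdifferentiable at $x$ iff it is $M$-directed subdifferentiable at $x$ for some $M\ge0$. *)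

theory Defs
  imports
    Complex_Main
    "HOL-Analysis.Sigma_Algebra"
    "HOL-Analysis.Topology_Euclidean_Space"
    "Jordan_Normal_Form.Matrix"
    "Jordan_Normal_Form.Determinant"
begin

text \<open>
  The space \<open>\<real>\<^sup>n\<close> is \<open>carrier_vec n :: real vec set\<close>, so that the dimension is an ordinary
  natural number.  Coordinates and unit vectors are numbered from \<open>0\<close>, so \<open>e\<^sup>n\<close> is
  \<open>unit_vec n (n - 1)\<close>.  Functions on \<open>\<real>\<^sup>n\<close> are HOL functions on \<open>real vec\<close> of which only the
  values on \<open>carrier_vec n\<close> matter.
\<close>

definition vec1 :: "real \<Rightarrow> real vec" where
  "vec1 r = vec 1 (\<lambda>_. r)"

definition vnorm :: "real vec \<Rightarrow> real" where
  "vnorm v = sqrt (scalar_prod v v)"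

definition unit_sphere :: "nat \<Rightarrow> real vec set" where
  "unit_sphere n = {l \<in> carrier_vec n. vnorm l = 1}"


section \<open>O-minimal structures\<close>

definition polynomial_on :: "nat \<Rightarrow> (real vec \<Rightarrow> real) \<Rightarrow> bool" where
  "polynomial_on n p \<longleftrightarrow>
     (\<exists>(K :: (nat \<Rightarrow> nat) set) (c :: (nat \<Rightarrow> nat) \<Rightarrow> real). finite K \<and>
        (\<forall>x\<in>carrier_vec n. p x = (\<Sum>\<alpha>\<in>K. c \<alpha> * (\<Prod>i<n. (x $ i) ^ \<alpha> i))))"

text \<open>
  The axioms are imposed only in dimensions \<open>n \<ge> 1\<close>.  The predicate \<open>is_interval\<close> covers bounded
  and unbounded intervals with any kind of end points, as well as single points.
  The qualified name \<open>Sigma_Algebra.algebra\<close> is the library's notion of a Boolean algebra of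
  subsets of a set, as opposed to the algebras of \<open>HOL-Algebra.Module\<close>.
\<close>

locale o_minimal_structure =
  fixes \<O> :: "nat \<Rightarrow> real vec set set"
  assumes boolean_algebra: "n \<ge> 1 \<Longrightarrow> Sigma_Algebra.algebra (carrier_vec n) (\<O> n)"
    and times_line: "n \<ge> 1 \<Longrightarrow> A \<in> \<O> n \<Longrightarrow> {a @\<^sub>v vec1 r | a r. a \<in> A} \<in> \<O> (n + 1)"
    and line_times: "n \<ge> 1 \<Longrightarrow> A \<in> \<O> n \<Longrightarrow> {vec1 r @\<^sub>v a | a r. a \<in> A} \<in> \<O> (n + 1)"
    and projection: "n \<ge> 1 \<Longrightarrow> A \<in> \<O> (n + 1) \<Longrightarrow> (\<lambda>v. vec_first v n) ` A \<in> \<O> n"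
    and polynomial_zeros: "n \<ge> 1 \<Longrightarrow> polynomial_on n p \<Longrightarrow> {x \<in> carrier_vec n. p x = 0} \<in> \<O> n"
    and dimension_one: "\<O> 1 = {vec1 ` (\<Union>F) | F. finite F \<and> (\<forall>I\<in>F. is_interval (I :: real set))}"

definition definable_map ::
    "(nat \<Rightarrow> real vec set set) \<Rightarrow> nat \<Rightarrow> nat \<Rightarrow> real vec set \<Rightarrow> (real vec \<Rightarrow> real vec) \<Rightarrow> bool" where
  "definable_map \<O> n m S F \<longleftrightarrow>
     S \<subseteq> carrier_vec n \<and> F ` S \<subseteq> carrier_vec m \<and> {x @\<^sub>v F x | x. x \<in> S} \<in> \<O> (n + m)"

definition definable_fun :: "(nat \<Rightarrow> real vec set set) \<Rightarrow> nat \<Rightarrow> (real vec \<Rightarrow> real) \<Rightarrow> bool" where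
  "definable_fun \<O> n f \<longleftrightarrow> definable_map \<O> n 1 (carrier_vec n) (\<lambda>x. vec1 (f x))"


section \<open>Lipschitz continuity, continuity, directional derivatives\<close>

definition locally_lipschitz :: "nat \<Rightarrow> (real vec \<Rightarrow> real) \<Rightarrow> bool" where
  "locally_lipschitz n f \<longleftrightarrow>
     (\<forall>x\<in>carrier_vec n. \<exists>r>0. \<exists>L\<ge>0. \<forall>y\<in>carrier_vec n. \<forall>z\<in>carrier_vec n.
        vnorm (y - x) < r \<longrightarrow> vnorm (z - x) < r \<longrightarrow> \<bar>f y - f z\<bar> \<le> L * vnorm (y - z))"

definition vcontinuous :: "nat \<Rightarrow> (real vec \<Rightarrow> real) \<Rightarrow> bool" where
  "vcontinuous n g \<longleftrightarrow>
     (\<forall>l\<in>carrier_vec n. \<forall>\<epsilon>>0. \<exists>\<delta>>0. \<forall>k\<in>carrier_vec n.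
        vnorm (k - l) < \<delta> \<longrightarrow> \<bar>g k - g l\<bar> < \<epsilon>)"

definition has_dir_deriv :: "(real vec \<Rightarrow> real) \<Rightarrow> real vec \<Rightarrow> real vec \<Rightarrow> real \<Rightarrow> bool" where
  "has_dir_deriv f x l D \<longleftrightarrow> ((\<lambda>t. (f (x + t \<cdot>\<^sub>v l) - f x) / t) \<longlongrightarrow> D) (at_right 0)"

definition dir_deriv_exists :: "(real vec \<Rightarrow> real) \<Rightarrow> real vec \<Rightarrow> real vec \<Rightarrow> bool" where
  "dir_deriv_exists f x l \<longleftrightarrow> (\<exists>D. has_dir_deriv f x l D)"

definition dir_deriv :: "(real vec \<Rightarrow> real) \<Rightarrow> real vec \<Rightarrow> real vec \<Rightarrow> real" where
  "dir_deriv f x l = (THE D. has_dir_deriv f x l D)"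


section \<open>Rotations and directed subdifferentiability\<close>

definition rotation_mat :: "nat \<Rightarrow> real mat \<Rightarrow> bool" where
  "rotation_mat n Q \<longleftrightarrow> Q \<in> carrier_mat n n \<and> transpose_mat Q * Q = 1\<^sub>m n \<and> det Q = 1"

text \<open>
  The image condition says \<open>Q (span {l}\<^sup>\<bottom>) = span {e\<^sup>1, \<dots>, e\<^sup>n\<^sup>-\<^sup>1}\<close>: the left-hand side is the
  image of the vectors orthogonal to \<open>l\<close>, the right-hand side consists of the vectors with last
  coordinate zero.
\<close>

definition rotation_family :: "(nat \<Rightarrow> real vec \<Rightarrow> real mat) \<Rightarrow> bool" where
  "rotation_family Rot \<longleftrightarrow>
     (\<forall>n\<ge>2. \<forall>l\<in>unit_sphere n.
        rotation_mat n (Rot n l) \<and>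
        Rot n l *\<^sub>v l = unit_vec n (n - 1) \<and>
        (\<lambda>v. Rot n l *\<^sub>v v) ` {v \<in> carrier_vec n. scalar_prod v l = 0}
          = {w \<in> carrier_vec n. w $ (n - 1) = 0})"

definition drop_last_mat :: "nat \<Rightarrow> real mat" where
  "drop_last_mat n = mat (n - 1) n (\<lambda>(i, j). if i = j then 1 else 0)"

definition Pi_mat :: "(nat \<Rightarrow> real vec \<Rightarrow> real mat) \<Rightarrow> nat \<Rightarrow> real vec \<Rightarrow> real mat" where
  "Pi_mat Rot n l = drop_last_mat n * Rot n l"

text \<open>
  In dimension \<open>0\<close>, where the notion is not defined, the value is \<open>False\<close> by convention; the
  recursion never reaches it from a positive dimension.
\<close>

fun M_directed_subdiff ::
    "(nat \<Rightarrow> real vec \<Rightarrow> real mat) \<Rightarrow> real \<Rightarrow> nat \<Rightarrow> (real vec \<Rightarrow> real) \<Rightarrow> real vec \<Rightarrow> bool" where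
  "M_directed_subdiff Rot M 0 f x \<longleftrightarrow> False"
| "M_directed_subdiff Rot M (Suc 0) f x \<longleftrightarrow>
     dir_deriv_exists f x (vec1 (-1)) \<and> dir_deriv_exists f x (vec1 1) \<and>
     max \<bar>dir_deriv f x (vec1 (-1))\<bar> \<bar>dir_deriv f x (vec1 1)\<bar> \<le> M"
| "M_directed_subdiff Rot M (Suc (Suc k)) f x \<longleftrightarrow>
     (\<forall>l\<in>carrier_vec (Suc (Suc k)). dir_deriv_exists f x l) \<and>
     vcontinuous (Suc (Suc k)) (dir_deriv f x) \<and>
     (\<forall>l\<in>unit_sphere (Suc (Suc k)). \<bar>dir_deriv f x l\<bar> \<le> M) \<and>
     (\<forall>l\<in>unit_sphere (Suc (Suc k)).
        M_directed_subdiff Rot M (Suc k)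
          (\<lambda>y. dir_deriv f x (l + transpose_mat (Pi_mat Rot (Suc (Suc k)) l) *\<^sub>v y))
          (0\<^sub>v (Suc k)))"

definition directed_subdifferentiable ::
    "(nat \<Rightarrow> real vec \<Rightarrow> real mat) \<Rightarrow> nat \<Rightarrow> (real vec \<Rightarrow> real) \<Rightarrow> real vec \<Rightarrow> bool" where
  "directed_subdifferentiable Rot n f x \<longleftrightarrow> (\<exists>M\<ge>0. M_directed_subdiff Rot M n f x)"

end

theory Submission
  imports Defs
begin

text \<open>
  A difference quotient of \<open>f\<close> at \<open>x\<close> along a ray is bounded near \<open>0\<close>, and each of its superlevel
  sets is definable in \<open>\<real>\<close>, hence a finite union of intervals, hence contains or misses a whole
  interval \<open>(0, \<epsilon>)\<close>.  A bounded function with this property cannot oscillate, so \<open>f'(x; l)\<close> exists;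
  the monotonicity theorem is not needed.  The limit is described by a first-order formula, so
  \<open>f'(x; \<cdot>)\<close> is again definable, and it inherits the local Lipschitz constant of \<open>f\<close> at \<open>x\<close>.
  Both properties pass to \<open>f\<^sub>l\<close>, because \<open>y \<mapsto> l + \<Pi>\<^sup>\<top> y\<close> is an affine isometry, and
  induction on the dimension applies with \<open>M\<close> equal to that Lipschitz constant throughout.
\<close>

section \<open>Vectors and polynomial functions\<close>

lemma index_vec_first: "i < n \<Longrightarrow> vec_first v n $ i = v $ i"
  by (simp add: vec_first_def)

lemma vec_first_append: "v \<in> carrier_vec n \<Longrightarrow> vec_first (v @\<^sub>v u) n = v"
  by (intro eq_vecI) (auto simp: index_vec_first)

lemma vec1_carrier [simp]: "vec1 r \<in> carrier_vec (Suc 0)"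
  by (simp add: vec1_def)

lemma append_vec1_carrier: "v \<in> carrier_vec n \<Longrightarrow> v @\<^sub>v vec1 r \<in> carrier_vec (Suc n)"
  using append_carrier_vec[OF _ vec1_carrier, of v n r] by simp

lemma append_vec1_index: "v \<in> carrier_vec n \<Longrightarrow> (v @\<^sub>v vec1 r) $ n = r"
  by (simp add: vec1_def)

lemma vec1_index [simp]: "vec1 r $ 0 = r"
  by (simp add: vec1_def)

lemma vec1_eq_iff [simp]: "vec1 r = vec1 s \<longleftrightarrow> r = s"
  by (metis vec1_index)

lemma polynomial_on_cong:
  assumes "\<And>x. x \<in> carrier_vec n \<Longrightarrow> p x = q x"
  shows "polynomial_on n p \<longleftrightarrow> polynomial_on n q"
  using assms unfolding polynomial_on_def by simp

lemma polynomial_on_monomial: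
  "polynomial_on n (\<lambda>x :: real vec. a * (\<Prod>i<n. (x $ i) ^ \<alpha> i))"
  unfolding polynomial_on_def by (rule exI[of _ "{\<alpha>}"]) auto

lemma polynomial_on_const: "polynomial_on n (\<lambda>x. a)"
  using polynomial_on_monomial[of n a "\<lambda>_. 0"] by simp

lemma polynomial_on_coord:
  assumes "i < n"
  shows "polynomial_on n (\<lambda>x :: real vec. x $ i)"
proof -
  have "(\<Prod>j<n. (x $ j) ^ (if j = i then 1 else 0)) = x $ i" for x :: "real vec"
  proof -
    have "(\<Prod>j<n. (x $ j) ^ (if j = i then 1 else 0)) = (\<Prod>j<n. if j = i then x $ j else 1)"
      by (rule prod.cong) auto
    then show ?thesis
      using assms by simp
  qed
  then show ?thesis
    using polynomial_on_monomial[of n 1 "\<lambda>j. if j = i then 1 else 0"] by simp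
qed

lemma polynomial_on_add:
  assumes "polynomial_on n p" "polynomial_on n q"
  shows "polynomial_on n (\<lambda>x. p x + q x)"
proof -
  obtain K c where K: "finite K"
    "\<And>x. x \<in> carrier_vec n \<Longrightarrow> p x = (\<Sum>\<alpha>\<in>K. c \<alpha> * (\<Prod>i<n. (x $ i) ^ \<alpha> i))"
    using assms(1) unfolding polynomial_on_def by blast
  obtain K' c' where K': "finite K'"
    "\<And>x. x \<in> carrier_vec n \<Longrightarrow> q x = (\<Sum>\<alpha>\<in>K'. c' \<alpha> * (\<Prod>i<n. (x $ i) ^ \<alpha> i))"
    using assms(2) unfolding polynomial_on_def by blast
  \<comment> \<open>The two sums run over different exponent sets, so both coefficient families are
    extended by zero to the union.\<close>
  let ?d = "\<lambda>\<alpha>. (if \<alpha> \<in> K then c \<alpha> else 0) + (if \<alpha> \<in> K' then c' \<alpha> else 0)"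
  have "p x + q x = (\<Sum>\<alpha>\<in>K \<union> K'. ?d \<alpha> * (\<Prod>i<n. (x $ i) ^ \<alpha> i))"
    if x: "x \<in> carrier_vec n" for x
  proof -
    have "p x = (\<Sum>\<alpha>\<in>K \<union> K'. (if \<alpha> \<in> K then c \<alpha> else 0) * (\<Prod>i<n. (x $ i) ^ \<alpha> i))"
      unfolding K(2)[OF x] by (rule sum.mono_neutral_cong_left) (use K K' in auto)
    moreover have "q x = (\<Sum>\<alpha>\<in>K \<union> K'. (if \<alpha> \<in> K' then c' \<alpha> else 0) * (\<Prod>i<n. (x $ i) ^ \<alpha> i))"
      unfolding K'(2)[OF x] by (rule sum.mono_neutral_cong_left) (use K K' in auto)
    ultimately show ?thesis
      by (simp add: sum.distrib[symmetric] distrib_right)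
  qed
  then show ?thesis
    unfolding polynomial_on_def using K(1) K'(1)
    by (intro exI[of _ "K \<union> K'"] exI[of _ ?d] conjI ballI) simp_all
qed

lemma polynomial_on_sum:
  assumes "\<And>j. j \<in> J \<Longrightarrow> polynomial_on n (p j)"
  shows "polynomial_on n (\<lambda>x. \<Sum>j\<in>J. p j x)"
  using assms
  by (induction J rule: infinite_finite_induct)
    (auto intro: polynomial_on_const polynomial_on_add)

lemma polynomial_on_mult:
  assumes "polynomial_on n p" "polynomial_on n q"
  shows "polynomial_on n (\<lambda>x. p x * q x)"
proof -
  obtain K c where K: "finite K"
    "\<And>x. x \<in> carrier_vec n \<Longrightarrow> p x = (\<Sum>\<alpha>\<in>K. c \<alpha> * (\<Prod>i<n. (x $ i) ^ \<alpha> i))"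
    using assms(1) unfolding polynomial_on_def by blast
  obtain K' c' where K': "finite K'"
    "\<And>x. x \<in> carrier_vec n \<Longrightarrow> q x = (\<Sum>\<alpha>\<in>K'. c' \<alpha> * (\<Prod>i<n. (x $ i) ^ \<alpha> i))"
    using assms(2) unfolding polynomial_on_def by blast
  \<comment> \<open>Different pairs of exponents may have the same sum. Summing monomials over pairs
    avoids collecting their coefficients.\<close>
  let ?r = "\<lambda>x. \<Sum>\<alpha>\<in>K. \<Sum>\<beta>\<in>K'. (c \<alpha> * c' \<beta>) * (\<Prod>i<n. (x $ i) ^ (\<alpha> i + \<beta> i))"
  have "polynomial_on n ?r"
    by (intro polynomial_on_sum polynomial_on_monomial)
  moreover have "p x * q x = ?r x" if "x \<in> carrier_vec n" for x
    unfolding K(2)[OF that] K'(2)[OF that] sum_product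
    by (simp add: power_add prod.distrib mult_ac)
  ultimately show ?thesis
    using polynomial_on_cong[of n "\<lambda>x. p x * q x" ?r] by blast
qed

lemma polynomial_on_power:
  "polynomial_on n p \<Longrightarrow> polynomial_on n (\<lambda>x. p x ^ k)"
  by (induction k) (auto intro: polynomial_on_const polynomial_on_mult)

lemma polynomial_on_prod:
  assumes "\<And>j. j \<in> J \<Longrightarrow> polynomial_on n (p j)"
  shows "polynomial_on n (\<lambda>x. \<Prod>j\<in>J. p j x)"
  using assms
  by (induction J rule: infinite_finite_induct)
    (auto intro: polynomial_on_const polynomial_on_mult)

lemma polynomial_on_diff:
  assumes "polynomial_on n p" "polynomial_on n q"
  shows "polynomial_on n (\<lambda>x. p x - q x)"
  using polynomial_on_add[OF assms(1) polynomial_on_mult[OF polynomial_on_const[of n "-1"] assms(2)]]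
  by simp

lemmas polynomial_on_intros =
  polynomial_on_const polynomial_on_coord polynomial_on_add polynomial_on_diff
  polynomial_on_mult polynomial_on_power polynomial_on_sum polynomial_on_prod

text \<open>Serves the treatment of quantifiers: a polynomial in the free variables stays polynomial
  once \<open>k\<close> bound variables are appended as further coordinates.\<close>

lemma polynomial_on_vec_first:
  assumes "polynomial_on n p"
  shows "polynomial_on (n + k) (\<lambda>w. p (vec_first w n))"
proof -
  obtain K c where K: "finite K"
    "\<And>x. x \<in> carrier_vec n \<Longrightarrow> p x = (\<Sum>\<alpha>\<in>K. c \<alpha> * (\<Prod>i<n. (x $ i) ^ \<alpha> i))"
    using assms unfolding polynomial_on_def by blast
  have "p (vec_first w n) = (\<Sum>\<alpha>\<in>K. c \<alpha> * (\<Prod>i<n. (w $ i) ^ \<alpha> i))" for w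
    by (subst K(2)) (auto simp: vec_first_def)
  then show ?thesis
    by (auto intro!: polynomial_on_intros)
qed

section \<open>Norms and projections\<close>

lemma vnorm_smult:
  assumes "v \<in> carrier_vec n"
  shows "vnorm (a \<cdot>\<^sub>v v) = \<bar>a\<bar> * vnorm v"
proof -
  have "(a \<cdot>\<^sub>v v) \<bullet> (a \<cdot>\<^sub>v v) = a\<^sup>2 * (v \<bullet> v)"
    using assms by (simp add: power2_eq_square)
  then show ?thesis
    by (simp add: vnorm_def real_sqrt_mult)
qed

lemma vnorm_nonneg: "0 \<le> vnorm v"
  by (simp add: vnorm_def scalar_prod_def sum_nonneg)

lemma vnorm_vec1: "vnorm (vec1 r) = \<bar>r\<bar>"
  by (simp add: vnorm_def scalar_prod_def vec1_def power2_eq_square[symmetric])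

text \<open>The rows of \<open>A\<close> are orthonormal, so moving one factor \<open>A\<close>
  across the scalar product turns the squared norm of the image into
  \<open>y \<bullet> (A * transpose_mat A *\<^sub>v y)\<close>, which is
  \<open>y \<bullet> y\<close>.\<close>

lemma vnorm_transpose_mult:
  assumes A: "A \<in> carrier_mat m n" and "A * transpose_mat A = 1\<^sub>m m" and y: "y \<in> carrier_vec m"
  shows "vnorm (transpose_mat A *\<^sub>v y) = vnorm y"
proof -
  have A': "transpose_mat A \<in> carrier_mat n m"
    using A by simp
  have x: "transpose_mat A *\<^sub>v y \<in> carrier_vec n"
    using A' y by (rule mult_mat_vec_carrier)
  have "(transpose_mat A *\<^sub>v y) \<bullet> (transpose_mat A *\<^sub>v y) = y \<bullet> (A *\<^sub>v (transpose_mat A *\<^sub>v y))"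
    by (rule transpose_vec_mult_scalar[OF A x y])
  also have "A *\<^sub>v (transpose_mat A *\<^sub>v y) = y"
    unfolding assoc_mult_mat_vec[OF A A' y, symmetric] using assms by simp
  finally show ?thesis by (simp add: vnorm_def)
qed

lemma drop_last_mat_mult_transpose:
  "drop_last_mat n * transpose_mat (drop_last_mat n) = 1\<^sub>m (n - 1)"
proof (rule eq_matI)
  fix i j assume ij: "i < dim_row (1\<^sub>m (n - 1) :: real mat)" "j < dim_col (1\<^sub>m (n - 1) :: real mat)"
  then have "(drop_last_mat n * transpose_mat (drop_last_mat n)) $$ (i, j)
      = (\<Sum>k\<in>{0..<n}. (if i = k then 1 else 0) * (if j = k then 1 else 0))"
    by (simp add: drop_last_mat_def scalar_prod_def)
  also have "\<dots> = (\<Sum>k\<in>{0..<n}. if i = k then if j = k then 1 else 0 else 0)"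
    by (rule sum.cong) auto
  also have "\<dots> = (1\<^sub>m (n - 1) :: real mat) $$ (i, j)"
    using ij by auto
  finally show "(drop_last_mat n * transpose_mat (drop_last_mat n)) $$ (i, j) = 1\<^sub>m (n - 1) $$ (i, j)" .
qed (simp_all add: drop_last_mat_def)

text \<open>Dropping the last row of an orthogonal matrix leaves orthonormal rows. With
  \<open>vnorm_transpose_mult\<close> this makes \<open>transpose_mat (Pi_mat Rot n l)\<close> an
  isometric embedding.\<close>

lemma
  assumes Q: "rotation_mat n (Rot n l)"
  shows Pi_mat_carrier: "Pi_mat Rot n l \<in> carrier_mat (n - 1) n"
    and Pi_mat_mult_transpose: "Pi_mat Rot n l * transpose_mat (Pi_mat Rot n l) = 1\<^sub>m (n - 1)"
proof -
  let ?Q = "Rot n l" and ?D = "drop_last_mat n"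
  have Q': "?Q \<in> carrier_mat n n" "transpose_mat ?Q \<in> carrier_mat n n"
    and D: "?D \<in> carrier_mat (n - 1) n" "transpose_mat ?D \<in> carrier_mat n (n - 1)"
    using Q by (auto simp: rotation_mat_def drop_last_mat_def)
  then show "Pi_mat Rot n l \<in> carrier_mat (n - 1) n"
    by (simp add: Pi_mat_def)
  \<comment> \<open>\<open>rotation_mat\<close> gives only the left inverse; for square matrices it
    is a right inverse too.\<close>
  have inv: "?Q * transpose_mat ?Q = 1\<^sub>m n"
    by (rule mat_mult_left_right_inverse[OF Q'(2,1)]) (use Q in \<open>simp add: rotation_mat_def\<close>)
  have "Pi_mat Rot n l * transpose_mat (Pi_mat Rot n l) = (?D * ?Q) * (transpose_mat ?Q * transpose_mat ?D)"
    unfolding Pi_mat_def using transpose_mult[OF D(1) Q'(1)] by simp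
  also have "\<dots> = ?D * (?Q * (transpose_mat ?Q * transpose_mat ?D))"
    by (rule assoc_mult_mat[OF D(1) Q'(1)]) (use Q' D in auto)
  also have "?Q * (transpose_mat ?Q * transpose_mat ?D) = (?Q * transpose_mat ?Q) * transpose_mat ?D"
    by (rule assoc_mult_mat[OF Q' D(2), symmetric])
  also have "\<dots> = transpose_mat ?D"
    unfolding inv using D(2) by simp
  finally show "Pi_mat Rot n l * transpose_mat (Pi_mat Rot n l) = 1\<^sub>m (n - 1)"
    by (simp add: drop_last_mat_mult_transpose)
qed

section \<open>Directional derivatives\<close>

lemma dir_deriv_eq:
  assumes "has_dir_deriv f x l D"
  shows "dir_deriv f x l = D"
  unfolding dir_deriv_def
proof (rule the_equality)
  show "D' = D" if "has_dir_deriv f x l D'" for D'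
    using tendsto_unique[OF trivial_limit_at_right_real] that assms
    unfolding has_dir_deriv_def by blast
qed (rule assms)

lemma dir_deriv_exists_iff: "dir_deriv_exists f x l \<longleftrightarrow> has_dir_deriv f x l (dir_deriv f x l)"
  unfolding dir_deriv_exists_def using dir_deriv_eq by metis

text \<open>Comparing a direction with the zero direction turns the Lipschitz estimate for
  derivatives into the bound \<open>dir_deriv_bound\<close>.\<close>

lemma has_dir_deriv_zero:
  assumes "x \<in> carrier_vec n"
  shows "has_dir_deriv f x (0\<^sub>v n) 0"
proof -
  have "x + t \<cdot>\<^sub>v 0\<^sub>v n = x" for t
    using assms by (intro eq_vecI) auto
  then show ?thesis by (simp add: has_dir_deriv_def)
qed

text \<open>Brings the limit into a form that the closure rules for definable predicates can take
  apart: no division, quantifiers over all reals, and only non-strict comparisons of values of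
  \<open>f\<close>.\<close>

lemma has_dir_deriv_iff_ineqs:
  "has_dir_deriv f x l D \<longleftrightarrow>
     (\<forall>e. 0 < e \<longrightarrow> (\<exists>d. 0 < d \<and> (\<forall>t. 0 < t \<and> t < d \<longrightarrow>
        f (x + t \<cdot>\<^sub>v l) \<le> f x + D * t + e * t \<and> f x + D * t - e * t \<le> f (x + t \<cdot>\<^sub>v l))))"
  (is "_ \<longleftrightarrow> (\<forall>e. 0 < e \<longrightarrow> ?R e)")
proof -
  have le_iff: "f (x + t \<cdot>\<^sub>v l) \<le> f x + D * t + e * t \<and> f x + D * t - e * t \<le> f (x + t \<cdot>\<^sub>v l)
      \<longleftrightarrow> \<bar>(f (x + t \<cdot>\<^sub>v l) - f x) / t - D\<bar> \<le> e" if "0 < t" for t e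
  proof -
    have "\<bar>(f (x + t \<cdot>\<^sub>v l) - f x) / t - D\<bar> \<le> e \<longleftrightarrow>
        (f (x + t \<cdot>\<^sub>v l) - f x) / t \<le> D + e \<and> D - e \<le> (f (x + t \<cdot>\<^sub>v l) - f x) / t"
      by (auto simp: abs_le_iff)
    also have "\<dots> \<longleftrightarrow> f (x + t \<cdot>\<^sub>v l) - f x \<le> (D + e) * t \<and> (D - e) * t \<le> f (x + t \<cdot>\<^sub>v l) - f x"
      using that by (simp add: pos_divide_le_eq pos_le_divide_eq)
    finally show ?thesis by (auto simp: algebra_simps)
  qed
  have "?R e \<longleftrightarrow> (\<forall>\<^sub>F t in at_right 0. \<bar>(f (x + t \<cdot>\<^sub>v l) - f x) / t - D\<bar> \<le> e)" for e
    unfolding eventually_at_right_field using le_iff by blast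
  moreover have "has_dir_deriv f x l D \<longleftrightarrow>
      (\<forall>e>0. \<forall>\<^sub>F t in at_right 0. \<bar>(f (x + t \<cdot>\<^sub>v l) - f x) / t - D\<bar> \<le> e)"
  proof
    assume "has_dir_deriv f x l D"
    then show "\<forall>e>0. \<forall>\<^sub>F t in at_right 0. \<bar>(f (x + t \<cdot>\<^sub>v l) - f x) / t - D\<bar> \<le> e"
      unfolding has_dir_deriv_def tendsto_iff dist_real_def
      by (auto intro: eventually_mono[OF _ less_imp_le])
  next
    assume le: "\<forall>e>0. \<forall>\<^sub>F t in at_right 0. \<bar>(f (x + t \<cdot>\<^sub>v l) - f x) / t - D\<bar> \<le> e"
    \<comment> \<open>The non-strict bound for \<open>e / 2\<close> yields the strict one for
      \<open>e\<close>.\<close>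
    have "\<forall>\<^sub>F t in at_right 0. \<bar>(f (x + t \<cdot>\<^sub>v l) - f x) / t - D\<bar> < e" if "0 < e" for e
    proof -
      have "\<forall>\<^sub>F t in at_right 0. \<bar>(f (x + t \<cdot>\<^sub>v l) - f x) / t - D\<bar> \<le> e / 2"
        using le that half_gt_zero by blast
      then show ?thesis
        by eventually_elim (use that in simp)
    qed
    then show "has_dir_deriv f x l D"
      unfolding has_dir_deriv_def tendsto_iff dist_real_def by blast
  qed
  ultimately show ?thesis by simp
qed

text \<open>The constant is a parameter while the radius is existential: the radius may change from
  one recursion level to the next, but one and the same constant has to serve as \<open>M\<close> on
  all of them.\<close>

definition lipschitz_near :: "nat \<Rightarrow> real \<Rightarrow> (real vec \<Rightarrow> real) \<Rightarrow> real vec \<Rightarrow> bool" where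
  "lipschitz_near n L f x \<longleftrightarrow>
     (\<exists>r>0. \<forall>y\<in>carrier_vec n. \<forall>z\<in>carrier_vec n.
        vnorm (y - x) < r \<longrightarrow> vnorm (z - x) < r \<longrightarrow> \<bar>f y - f z\<bar> \<le> L * vnorm (y - z))"

text \<open>For small \<open>t > 0\<close> both points lie in the ball of the Lipschitz estimate, at
  distance \<open>t * vnorm (l - k)\<close>, and the factor \<open>t\<close> cancels. The radius
  leaves no trace in the bound, so \<open>l\<close> and \<open>k\<close> may have any size.\<close>

lemma difference_quotient_lipschitz:
  assumes lip: "lipschitz_near n L f x"
    and x: "x \<in> carrier_vec n" and l: "l \<in> carrier_vec n" and k: "k \<in> carrier_vec n"
  shows "\<forall>\<^sub>F t in at_right 0.
    \<bar>(f (x + t \<cdot>\<^sub>v l) - f x) / t - (f (x + t \<cdot>\<^sub>v k) - f x) / t\<bar> \<le> L * vnorm (l - k)"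
proof -
  obtain r where r: "0 < r" "\<And>y z. y \<in> carrier_vec n \<Longrightarrow> z \<in> carrier_vec n \<Longrightarrow>
      vnorm (y - x) < r \<Longrightarrow> vnorm (z - x) < r \<Longrightarrow> \<bar>f y - f z\<bar> \<le> L * vnorm (y - z)"
    using lip unfolding lipschitz_near_def by blast
  have near: "\<forall>\<^sub>F t in at_right 0. vnorm ((x + t \<cdot>\<^sub>v v) - x) < r" if v: "v \<in> carrier_vec n" for v
  proof -
    have "(x + t \<cdot>\<^sub>v v) - x = t \<cdot>\<^sub>v v" for t
      using x v by (intro eq_vecI) auto
    then have "vnorm ((x + t \<cdot>\<^sub>v v) - x) = \<bar>t\<bar> * vnorm v" for t
      using vnorm_smult[OF v] by simp
    moreover have "((\<lambda>t. \<bar>t\<bar> * vnorm v) \<longlongrightarrow> 0) (at_right 0)"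
      by (auto intro!: tendsto_eq_intros)
    ultimately show ?thesis
      using order_tendstoD(2) r(1) by fastforce
  qed
  show ?thesis
    using near[OF l] near[OF k] eventually_at_right_less[of "0 :: real"]
  proof eventually_elim
    case (elim t)
    have "(x + t \<cdot>\<^sub>v l) - (x + t \<cdot>\<^sub>v k) = t \<cdot>\<^sub>v (l - k)"
      using x l k by (intro eq_vecI) (auto simp: algebra_simps)
    then have "vnorm ((x + t \<cdot>\<^sub>v l) - (x + t \<cdot>\<^sub>v k)) = t * vnorm (l - k)"
      using vnorm_smult[of "l - k" n t] l k elim(3) by simp
    moreover have "\<bar>f (x + t \<cdot>\<^sub>v l) - f (x + t \<cdot>\<^sub>v k)\<bar> \<le> L * vnorm ((x + t \<cdot>\<^sub>v l) - (x + t \<cdot>\<^sub>v k))"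
      by (rule r(2)) (use x l k elim in auto)
    ultimately have "\<bar>f (x + t \<cdot>\<^sub>v l) - f (x + t \<cdot>\<^sub>v k)\<bar> / t \<le> L * vnorm (l - k)"
      using elim(3) by (simp add: pos_divide_le_eq mult_ac)
    then show ?case
      using elim(3) by (simp add: diff_divide_distrib[symmetric] abs_divide)
  qed
qed

text \<open>A non-strict bound survives the limit. A local Lipschitz property of \<open>f\<close>
  thus becomes a global one of its derivative, with the same constant.\<close>

lemma dir_deriv_lipschitz:
  assumes "lipschitz_near n L f x" "x \<in> carrier_vec n" "l \<in> carrier_vec n" "k \<in> carrier_vec n"
    and "dir_deriv_exists f x l" "dir_deriv_exists f x k"
  shows "\<bar>dir_deriv f x l - dir_deriv f x k\<bar> \<le> L * vnorm (l - k)"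
proof (rule tendsto_upperbound)
  show "((\<lambda>t. \<bar>(f (x + t \<cdot>\<^sub>v l) - f x) / t - (f (x + t \<cdot>\<^sub>v k) - f x) / t\<bar>)
      \<longlongrightarrow> \<bar>dir_deriv f x l - dir_deriv f x k\<bar>) (at_right 0)"
    using assms(5,6) unfolding dir_deriv_exists_iff has_dir_deriv_def
    by (intro tendsto_rabs tendsto_diff)
qed (use difference_quotient_lipschitz[OF assms(1-4)] in simp_all)

lemma dir_deriv_bound:
  assumes "lipschitz_near n L f x" "x \<in> carrier_vec n" "l \<in> carrier_vec n" "dir_deriv_exists f x l"
  shows "\<bar>dir_deriv f x l\<bar> \<le> L * vnorm l"
proof -
  have zero: "dir_deriv_exists f x (0\<^sub>v n)" "dir_deriv f x (0\<^sub>v n) = 0"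
    using has_dir_deriv_zero[OF assms(2), of f] dir_deriv_eq unfolding dir_deriv_exists_def by blast+
  have "l - 0\<^sub>v n = l"
    using assms(3) by (intro eq_vecI) auto
  then show ?thesis
    using dir_deriv_lipschitz[OF assms(1-3) zero_carrier_vec assms(4) zero(1)] zero(2) by simp
qed

section \<open>Limits of tame functions\<close>

text \<open>An interval with points arbitrarily close to \<open>a\<close> on the right contains
  everything between \<open>a\<close> and any one of its points beyond \<open>a\<close>; otherwise
  it misses some \<open>(a, b)\<close>. Finitely many such alternatives combine by
  induction.\<close>

lemma finite_union_intervals_at_right:
  fixes F :: "real set set"
  assumes "finite F" "\<And>I. I \<in> F \<Longrightarrow> is_interval I"
  shows "(\<forall>\<^sub>F t in at_right a. t \<in> \<Union>F) \<or> (\<forall>\<^sub>F t in at_right a. t \<notin> \<Union>F)"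
  using assms
proof (induction F rule: finite_induct)
  case (insert I F)
  have "(\<forall>\<^sub>F t in at_right a. t \<in> I) \<or> (\<forall>\<^sub>F t in at_right a. t \<notin> I)"
  proof (cases "\<forall>b>a. \<exists>t\<in>I. a < t \<and> t < b")
    case True
    then obtain b where b: "b \<in> I" "a < b"
      by (meson gt_ex)
    have "t \<in> I" if t: "a < t" "t < b" for t
    proof -
      obtain s where "s \<in> I" "a < s" "s < t"
        using True t by blast
      moreover have "is_interval I"
        by (rule insert.prems) simp
      ultimately show ?thesis
        using b(1) t(2) unfolding is_interval_1 by (meson less_imp_le)
    qed
    then show ?thesis
      using b by (auto simp: eventually_at_right_field)
  next
    case False
    then show ?thesis
      by (auto simp: eventually_at_right_field)
  qed
  moreover have "(\<forall>\<^sub>F t in at_right a. t \<in> \<Union>F) \<or> (\<forall>\<^sub>F t in at_right a. t \<notin> \<Union>F)"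
    using insert by blast
  ultimately consider "\<forall>\<^sub>F t in at_right a. t \<in> I" | "\<forall>\<^sub>F t in at_right a. t \<in> \<Union>F"
    | "\<forall>\<^sub>F t in at_right a. t \<notin> I \<and> t \<notin> \<Union>F"
    using eventually_conj by blast
  then show ?case
  proof cases
    case 1
    then have "\<forall>\<^sub>F t in at_right a. t \<in> \<Union>(insert I F)"
      by eventually_elim simp
    then show ?thesis ..
  next
    case 2
    then have "\<forall>\<^sub>F t in at_right a. t \<in> \<Union>(insert I F)"
      by eventually_elim auto
    then show ?thesis ..
  next
    case 3
    then have "\<forall>\<^sub>F t in at_right a. t \<notin> \<Union>(insert I F)"
      by eventually_elim simp
    then show ?thesis ..
  qed
qed auto

text \<open>Oscillation would leave a level \<open>c\<close> strictly between the lower and the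
  upper limit undecided. The limit is found as the supremum of the levels that are eventually
  exceeded.\<close>

lemma tendsto_if_levels_decided:
  fixes g :: "'a \<Rightarrow> real"
  assumes "F \<noteq> bot"
    and bounded: "\<forall>\<^sub>F t in F. \<bar>g t\<bar> \<le> B"
    and decided: "\<And>c. (\<forall>\<^sub>F t in F. c < g t) \<or> (\<forall>\<^sub>F t in F. g t \<le> c)"
  shows "\<exists>D. (g \<longlongrightarrow> D) F"
proof -
  define S where "S = {c. \<forall>\<^sub>F t in F. c < g t}"
  \<comment> \<open>The level \<open>- B\<close> itself may fail, since membership in
    \<open>S\<close> asks for a strict inequality.\<close>
  have "- B - 1 \<in> S"
    unfolding S_def mem_Collect_eq using bounded by eventually_elim auto
  have upper: "c \<le> B" if "c \<in> S" for c
  proof -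
    have "\<forall>\<^sub>F t in F. c < g t \<and> \<bar>g t\<bar> \<le> B"
      using that bounded unfolding S_def by (auto intro: eventually_conj)
    then have "\<exists>t. c < g t \<and> \<bar>g t\<bar> \<le> B"
      using \<open>F \<noteq> bot\<close> eventually_happens by blast
    then show ?thesis by auto
  qed
  then have bdd: "bdd_above S" by (rule bdd_aboveI)
  have "(g \<longlongrightarrow> Sup S) F"
  proof (rule order_tendstoI)
    fix a assume "a < Sup S"
    then obtain c where "c \<in> S" "a < c"
      using less_cSup_iff[of S a] \<open>- B - 1 \<in> S\<close> bdd by blast
    then have "\<forall>\<^sub>F t in F. c < g t"
      unfolding S_def by simp
    then show "\<forall>\<^sub>F t in F. a < g t"
      by eventually_elim (use \<open>a < c\<close> in simp)
  next
    fix a assume "Sup S < a"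
    \<comment> \<open>A level outside \<open>S\<close> gives only \<open>g t \<le> c\<close>;
      choosing it below \<open>a\<close> restores strictness.\<close>
    then obtain c where c: "Sup S < c" "c < a"
      using dense by blast
    then have "c \<notin> S"
      using cSup_upper[OF _ bdd] by force
    then have "\<forall>\<^sub>F t in F. g t \<le> c"
      using decided unfolding S_def by blast
    then show "\<forall>\<^sub>F t in F. g t < a"
      by eventually_elim (use c in simp)
  qed
  then show ?thesis ..
qed

section \<open>Definability\<close>

context o_minimal_structure
begin

text \<open>Predicates in place of sets allow a first-order formula to be shown definable with one
  rule per connective, its free variables being the coordinates of a single vector.\<close>

definition definable_pred :: "nat \<Rightarrow> (real vec \<Rightarrow> bool) \<Rightarrow> bool" where
  "definable_pred n P \<longleftrightarrow> {v \<in> carrier_vec n. P v} \<in> \<O> n"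

lemma definable_pred_cong:
  assumes "definable_pred n P" "\<And>v. v \<in> carrier_vec n \<Longrightarrow> P v \<longleftrightarrow> Q v"
  shows "definable_pred n Q"
proof -
  have "{v \<in> carrier_vec n. P v} = {v \<in> carrier_vec n. Q v}"
    using assms(2) by blast
  then show ?thesis using assms(1) by (simp add: definable_pred_def)
qed

lemma definable_pred_mem:
  assumes "n \<ge> 1" "A \<in> \<O> n"
  shows "definable_pred n (\<lambda>v. v \<in> A)"
proof -
  interpret Sigma_Algebra.algebra "carrier_vec n" "\<O> n"
    by (rule boolean_algebra[OF assms(1)])
  have "{v \<in> carrier_vec n. v \<in> A} = A"
    using sets_into_space[OF assms(2)] by blast
  then show ?thesis using assms(2) by (simp add: definable_pred_def)
qed

section \<open>Closure of definable predicates under connectives and quantifiers\<close>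

lemma definable_pred_not:
  assumes "n \<ge> 1" "definable_pred n P"
  shows "definable_pred n (\<lambda>v. \<not> P v)"
proof -
  interpret Sigma_Algebra.algebra "carrier_vec n" "\<O> n"
    by (rule boolean_algebra[OF assms(1)])
  show ?thesis
    using assms(2) sets_Collect_neg unfolding definable_pred_def by blast
qed

lemma definable_pred_conj:
  assumes "n \<ge> 1" "definable_pred n P" "definable_pred n Q"
  shows "definable_pred n (\<lambda>v. P v \<and> Q v)"
proof -
  interpret Sigma_Algebra.algebra "carrier_vec n" "\<O> n"
    by (rule boolean_algebra[OF assms(1)])
  show ?thesis
    using assms(2,3) sets_Collect_conj unfolding definable_pred_def by blast
qed

lemma definable_pred_imp:
  assumes "n \<ge> 1" "definable_pred n P" "definable_pred n Q"
  shows "definable_pred n (\<lambda>v. P v \<longrightarrow> Q v)"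
  using definable_pred_not[OF assms(1) definable_pred_conj[OF assms(1,2) definable_pred_not[OF assms(1,3)]]]
  by simp

lemma definable_pred_polynomial_zero:
  "n \<ge> 1 \<Longrightarrow> polynomial_on n p \<Longrightarrow> definable_pred n (\<lambda>v. p v = 0)"
  unfolding definable_pred_def by (rule polynomial_zeros)

lemma definable_pred_Ball_less:
  fixes m :: nat
  assumes "n \<ge> 1" "\<And>i. i < m \<Longrightarrow> definable_pred n (P i)"
  shows "definable_pred n (\<lambda>v. \<forall>i<m. P i v)"
  using assms(2)
proof (induction m)
  case 0
  \<comment> \<open>The empty conjunction is true everywhere, being the zero set of the zero
    polynomial.\<close>
  then show ?case
    using definable_pred_polynomial_zero[OF assms(1) polynomial_on_const[of n 0]] by simp
next
  case (Suc m)
  have "definable_pred n (\<lambda>v. (\<forall>i<m. P i v) \<and> P m v)"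
    by (rule definable_pred_conj[OF assms(1)]) (use Suc in auto)
  then show ?case
    by (rule definable_pred_cong) (auto simp: less_Suc_eq)
qed

text \<open>An existential quantifier is a projection. The bound variable is the last coordinate
  because that is the one which the projection axiom removes.\<close>

lemma definable_pred_ex:
  assumes "n \<ge> 1" "definable_pred (Suc n) (\<lambda>w. P (vec_first w n) (w $ n))"
  shows "definable_pred n (\<lambda>v. \<exists>r. P v r)"
proof -
  let ?A = "{w \<in> carrier_vec (Suc n). P (vec_first w n) (w $ n)}"
  have "(\<lambda>v. vec_first v n) ` ?A = {v \<in> carrier_vec n. \<exists>r. P v r}"
  proof (intro equalityI subsetI)
    fix v assume "v \<in> {v \<in> carrier_vec n. \<exists>r. P v r}"
    then obtain r where v: "v \<in> carrier_vec n" "P v r" by blast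
    have first: "vec_first (v @\<^sub>v vec1 r) n = v"
      using v(1) by (simp add: vec_first_append)
    have "v @\<^sub>v vec1 r \<in> ?A"
      using v first by (simp add: append_vec1_carrier append_vec1_index)
    then show "v \<in> (\<lambda>v. vec_first v n) ` ?A"
      by (rule image_eqI[rotated]) (simp add: first)
  qed auto
  then show ?thesis
    using projection[OF assms(1), of ?A] assms(2) by (simp add: definable_pred_def)
qed

lemma definable_pred_all:
  assumes "n \<ge> 1" "definable_pred (Suc n) (\<lambda>w. P (vec_first w n) (w $ n))"
  shows "definable_pred n (\<lambda>v. \<forall>r. P v r)"
proof -
  have "definable_pred n (\<lambda>v. \<not> (\<exists>r. \<not> P v r))"
    by (intro definable_pred_not definable_pred_ex assms) (use assms in auto)
  then show ?thesis by simp
qed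

text \<open>The \<open>k\<close> bound coordinates are projected away one at a time, starting from
  the last.\<close>

lemma definable_pred_ex_vec:
  assumes "n \<ge> 1" "definable_pred (n + k) P"
  shows "definable_pred n (\<lambda>v. \<exists>u\<in>carrier_vec k. P (v @\<^sub>v u))"
  using assms(2)
proof (induction k arbitrary: P)
  case 0
  have "(v @\<^sub>v u) = v" if "v \<in> carrier_vec n" "u \<in> carrier_vec 0" for v u :: "real vec"
    using that by (intro eq_vecI) auto
  then have eq: "P v \<longleftrightarrow> (\<exists>u\<in>carrier_vec 0. P (v @\<^sub>v u))" if "v \<in> carrier_vec n" for v
    using that by (metis vec_carrier)
  show ?case
    by (rule definable_pred_cong[OF _ eq]) (use 0 in simp_all)
next
  case (Suc k)
  have "vec_first w (n + k) @\<^sub>v vec1 (w $ (n + k)) = w" if "w \<in> carrier_vec (Suc (n + k))" for w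
    using that by (intro eq_vecI) (auto simp: vec_first_def vec1_def less_Suc_eq)
  then have eq: "P w \<longleftrightarrow> P (vec_first w (n + k) @\<^sub>v vec1 (w $ (n + k)))"
    if "w \<in> carrier_vec (Suc (n + k))" for w
    using that by simp
  have "definable_pred (Suc (n + k)) (\<lambda>w. P (vec_first w (n + k) @\<^sub>v vec1 (w $ (n + k))))"
    by (rule definable_pred_cong[OF _ eq]) (use Suc.prems in simp_all)
  then have "definable_pred (n + k) (\<lambda>v. \<exists>r. P (v @\<^sub>v vec1 r))"
    using definable_pred_ex[of "n + k" "\<lambda>v r. P (v @\<^sub>v vec1 r)"] assms(1) by simp
  then have *: "definable_pred n (\<lambda>v. \<exists>u\<in>carrier_vec k. \<exists>r. P ((v @\<^sub>v u) @\<^sub>v vec1 r))"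
    by (rule Suc.IH)
  have "(\<exists>u\<in>carrier_vec k. \<exists>r. P ((v @\<^sub>v u) @\<^sub>v vec1 r)) \<longleftrightarrow> (\<exists>u\<in>carrier_vec (Suc k). P (v @\<^sub>v u))"
    if v: "v \<in> carrier_vec n" for v
  proof
    assume "\<exists>u\<in>carrier_vec k. \<exists>r. P ((v @\<^sub>v u) @\<^sub>v vec1 r)"
    then obtain u r where u: "u \<in> carrier_vec k" "P ((v @\<^sub>v u) @\<^sub>v vec1 r)" by blast
    have "(v @\<^sub>v u) @\<^sub>v vec1 r = v @\<^sub>v (u @\<^sub>v vec1 r)"
      using u(1) v by (intro eq_vecI) (auto simp: vec1_def)
    moreover have "u @\<^sub>v vec1 r \<in> carrier_vec (Suc k)"
      using u(1) by (rule append_vec1_carrier)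
    ultimately show "\<exists>u\<in>carrier_vec (Suc k). P (v @\<^sub>v u)"
      using u(2) by (intro bexI[of _ "u @\<^sub>v vec1 r"]) simp_all
  next
    assume "\<exists>u\<in>carrier_vec (Suc k). P (v @\<^sub>v u)"
    then obtain u where u: "u \<in> carrier_vec (Suc k)" "P (v @\<^sub>v u)" by blast
    have "v @\<^sub>v u = (v @\<^sub>v vec_first u k) @\<^sub>v vec1 (u $ k)"
      using u v by (intro eq_vecI) (auto simp: vec_first_def vec1_def less_Suc_eq)
    then show "\<exists>u\<in>carrier_vec k. \<exists>r. P ((v @\<^sub>v u) @\<^sub>v vec1 r)"
      using u(2) by (intro bexI[of _ "vec_first u k"] exI[of _ "u $ k"]) simp_all
  qed
  then show ?case
    by (rule definable_pred_cong[OF *])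
qed

section \<open>Substitution of polynomials into definable sets\<close>

text \<open>This set is the cylinder \<real>\<open>\<^sup>k\<close> \<times> \<open>A\<close>, built
  by \<open>k\<close> uses of \<open>line_times\<close>.\<close>

lemma definable_pred_last:
  assumes "m \<ge> 1" "A \<in> \<O> m"
  shows "definable_pred (k + m) (\<lambda>w. vec m (\<lambda>i. w $ (k + i)) \<in> A)"
proof (induction k)
  case 0
  have eq: "w \<in> A \<longleftrightarrow> vec m (\<lambda>i. w $ (0 + i)) \<in> A" if "w \<in> carrier_vec (0 + m)" for w
  proof -
    have "vec m (\<lambda>i. w $ (0 + i)) = w"
      using that by auto
    then show ?thesis by simp
  qed
  show ?case
    by (rule definable_pred_cong[OF _ eq]) (use definable_pred_mem[OF assms] in simp_all)
next
  case (Suc k)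
  let ?B = "{w \<in> carrier_vec (k + m). vec m (\<lambda>i. w $ (k + i)) \<in> A}"
  have "{w \<in> carrier_vec (Suc k + m). vec m (\<lambda>i. w $ (Suc k + i)) \<in> A}
      = {vec1 r @\<^sub>v a | a r. a \<in> ?B}"
  proof (intro equalityI subsetI)
    fix w assume w: "w \<in> {w \<in> carrier_vec (Suc k + m). vec m (\<lambda>i. w $ (Suc k + i)) \<in> A}"
    let ?a = "vec (k + m) (\<lambda>i. w $ Suc i)"
    have "w = vec1 (w $ 0) @\<^sub>v ?a"
      using w by (intro eq_vecI) (auto simp: vec1_def)
    moreover have "vec m (\<lambda>i. ?a $ (k + i)) = vec m (\<lambda>i. w $ (Suc k + i))"
      by (intro eq_vecI) auto
    ultimately show "w \<in> {vec1 r @\<^sub>v a | a r. a \<in> ?B}"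
      using w by auto
  next
    fix w assume "w \<in> {vec1 r @\<^sub>v a | a r. a \<in> ?B}"
    then obtain a r where a: "a \<in> ?B" "w = vec1 r @\<^sub>v a" by blast
    have "vec m (\<lambda>i. w $ (Suc k + i)) = vec m (\<lambda>i. a $ (k + i))"
      using a by (intro eq_vecI) (auto simp: vec1_def)
    then show "w \<in> {w \<in> carrier_vec (Suc k + m). vec m (\<lambda>i. w $ (Suc k + i)) \<in> A}"
      using a append_carrier_vec[OF vec1_carrier[of r], of a "k + m"] by simp
  qed
  then show ?case
    using line_times[of "k + m" ?B] Suc assms(1) by (simp add: definable_pred_def)
qed

lemma definable_pred_subst:
  assumes n: "n \<ge> 1" and m: "m \<ge> 1" and A: "A \<in> \<O> m"
    and q: "\<And>i. i < m \<Longrightarrow> polynomial_on n (q i)"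
  shows "definable_pred n (\<lambda>v. vec m (\<lambda>i. q i v) \<in> A)"
proof -
  \<comment> \<open>The preimage of \<open>A\<close> under \<open>q\<close> is the projection of the graph of \<open>q\<close> cut with \<open>\<real>\<^sup>n \<times> A\<close>.\<close>
  let ?P = "\<lambda>w. vec m (\<lambda>i. w $ (n + i)) \<in> A \<and> (\<forall>i<m. w $ (n + i) - q i (vec_first w n) = 0)"
  have "polynomial_on (n + m) (\<lambda>w. w $ (n + i) - q i (vec_first w n))" if "i < m" for i
    using that polynomial_on_vec_first[OF q[OF that], of m]
    by (intro polynomial_on_diff polynomial_on_coord) simp_all
  then have "definable_pred (n + m) (\<lambda>w. \<forall>i<m. w $ (n + i) - q i (vec_first w n) = 0)"
    using n by (intro definable_pred_Ball_less definable_pred_polynomial_zero) simp_all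
  then have "definable_pred (n + m) ?P"
    using n by (intro definable_pred_conj definable_pred_last[OF m A]) simp_all
  then have *: "definable_pred n (\<lambda>v. \<exists>u\<in>carrier_vec m. ?P (v @\<^sub>v u))"
    by (rule definable_pred_ex_vec[OF n])
  have "(\<exists>u\<in>carrier_vec m. ?P (v @\<^sub>v u)) \<longleftrightarrow> vec m (\<lambda>i. q i v) \<in> A"
    if v: "v \<in> carrier_vec n" for v
  proof -
    have "?P (v @\<^sub>v u) \<longleftrightarrow> u \<in> A \<and> u = vec m (\<lambda>i. q i v)" if u: "u \<in> carrier_vec m" for u
    proof -
      have "vec m (\<lambda>i. (v @\<^sub>v u) $ (n + i)) = u"
        using u v by (intro eq_vecI) auto
      moreover have "vec_first (v @\<^sub>v u) n = v"
        using v by (simp add: vec_first_append)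
      moreover have "(\<forall>i<m. (v @\<^sub>v u) $ (n + i) - q i v = 0) \<longleftrightarrow> u = vec m (\<lambda>i. q i v)"
        using u v by (auto simp: Matrix.vec_eq_iff)
      ultimately show ?thesis by simp
    qed
    then show ?thesis by auto
  qed
  then show ?thesis
    by (rule definable_pred_cong[OF *])
qed

section \<open>Order relations and values of definable functions\<close>

text \<open>The axioms supply polynomial equations only; the order is recovered because the
  nonnegative reals are exactly the squares, the root being a projected coordinate.\<close>

lemma definable_pred_nonneg:
  assumes n: "n \<ge> 1" and p: "polynomial_on n p"
  shows "definable_pred n (\<lambda>v. 0 \<le> p v)"
proof -
  have "polynomial_on (Suc n) (\<lambda>w. p (vec_first w n) - (w $ n)\<^sup>2)"
    using polynomial_on_vec_first[OF p, of 1] by (intro polynomial_on_intros) auto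
  then have "definable_pred (Suc n) (\<lambda>w. p (vec_first w n) - (w $ n)\<^sup>2 = 0)"
    by (intro definable_pred_polynomial_zero) auto
  then have "definable_pred n (\<lambda>v. \<exists>r. p v - r\<^sup>2 = 0)"
    by (rule definable_pred_ex[OF n])
  moreover have "(\<exists>r. p v - r\<^sup>2 = 0) \<longleftrightarrow> 0 \<le> p v" for v
    by (metis eq_iff_diff_eq_0 real_sqrt_pow2 zero_le_power2)
  ultimately show ?thesis by simp
qed

lemma definable_pred_less:
  assumes "n \<ge> 1" "polynomial_on n p" "polynomial_on n q"
  shows "definable_pred n (\<lambda>v. p v < q v)"
  using definable_pred_not[OF assms(1) definable_pred_nonneg[OF assms(1) polynomial_on_diff[OF assms(2,3)]]]
  by (simp add: not_le)

text \<open>The equation says that the polynomial map sending \<open>w\<close> to the pair of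
  \<open>q w\<close> and \<open>r w\<close> hits the graph of \<open>f\<close>, so
  \<open>definable_pred_subst\<close> applies to that graph.\<close>

lemma definable_pred_fun_eq:
  fixes q :: "real vec \<Rightarrow> real vec"
  assumes N: "N \<ge> 1" and f: "definable_fun \<O> n f"
    and q: "\<And>w. q w \<in> carrier_vec n" "\<And>i. i < n \<Longrightarrow> polynomial_on N (\<lambda>w. q w $ i)"
    and r: "polynomial_on N r"
  shows "definable_pred N (\<lambda>w. f (q w) = r w)"
proof -
  let ?A = "{x @\<^sub>v vec1 (f x) | x. x \<in> carrier_vec n}"
  have A: "?A \<in> \<O> (Suc n)"
    using f by (simp add: definable_fun_def definable_map_def)
  have "definable_pred N (\<lambda>w. vec (Suc n) (\<lambda>i. if i < n then q w $ i else r w) \<in> ?A)"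
  proof (rule definable_pred_subst[OF N _ A])
    fix i
    show "polynomial_on N (\<lambda>w. if i < n then q w $ i else r w)"
      using q(2) r by (cases "i < n") simp_all
  qed simp
  moreover have "vec (Suc n) (\<lambda>i. if i < n then q w $ i else r w) \<in> ?A \<longleftrightarrow> f (q w) = r w" for w
  proof -
    have "vec (Suc n) (\<lambda>i. if i < n then q w $ i else r w) = q w @\<^sub>v vec1 (r w)"
      using q(1)[of w] by (intro eq_vecI) (auto simp: vec1_def)
    moreover have "q w @\<^sub>v vec1 (r w) \<in> ?A \<longleftrightarrow> f (q w) = r w"
    proof
      assume "q w @\<^sub>v vec1 (r w) \<in> ?A"
      then obtain x where "x \<in> carrier_vec n" "q w @\<^sub>v vec1 (r w) = x @\<^sub>v vec1 (f x)" by blast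
      then show "f (q w) = r w"
        using append_vec_eq[OF q(1)[of w], of x "vec1 (r w)" "vec1 (f x)"] by simp
    next
      assume "f (q w) = r w"
      then show "q w @\<^sub>v vec1 (r w) \<in> ?A"
        using q(1)[of w] by (intro CollectI exI[of _ "q w"]) simp
    qed
    ultimately show ?thesis by simp
  qed
  ultimately show ?thesis by simp
qed

text \<open>The graph controls \<open>f\<close> only through equations, so each inequality becomes
  an equation with a square as slack, the square of a quantified variable \<open>s\<close>.\<close>

lemma definable_pred_fun_le:
  fixes q :: "real vec \<Rightarrow> real vec"
  assumes N: "N \<ge> 1" and f: "definable_fun \<O> n f"
    and q: "\<And>w. q w \<in> carrier_vec n" "\<And>i. i < n \<Longrightarrow> polynomial_on N (\<lambda>w. q w $ i)"
    and r: "polynomial_on N r"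
  shows "definable_pred N (\<lambda>w. f (q w) \<le> r w)"
    and "definable_pred N (\<lambda>w. r w \<le> f (q w))"
proof -
  have q': "polynomial_on (Suc N) (\<lambda>w. q (vec_first w N) $ i)" if "i < n" for i
    using polynomial_on_vec_first[OF q(2)[OF that], of 1] by simp
  have r': "polynomial_on (Suc N) (\<lambda>w. r (vec_first w N))"
    using polynomial_on_vec_first[OF r, of 1] by simp
  have "definable_pred N (\<lambda>w. \<exists>s. f (q w) = r w - s\<^sup>2)"
    by (intro definable_pred_ex[OF N] definable_pred_fun_eq[OF _ f] q(1) q' r' polynomial_on_intros) auto
  moreover have "(\<exists>s. f (q w) = r w - s\<^sup>2) \<longleftrightarrow> f (q w) \<le> r w" for w
  proof
    assume "f (q w) \<le> r w"
    then have "f (q w) = r w - (sqrt (r w - f (q w)))\<^sup>2" by simp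
    then show "\<exists>s. f (q w) = r w - s\<^sup>2" by blast
  qed auto
  ultimately show "definable_pred N (\<lambda>w. f (q w) \<le> r w)" by simp
  have "definable_pred N (\<lambda>w. \<exists>s. f (q w) = r w + s\<^sup>2)"
    by (intro definable_pred_ex[OF N] definable_pred_fun_eq[OF _ f] q(1) q' r' polynomial_on_intros) auto
  moreover have "(\<exists>s. f (q w) = r w + s\<^sup>2) \<longleftrightarrow> r w \<le> f (q w)" for w
  proof
    assume "r w \<le> f (q w)"
    then have "f (q w) = r w + (sqrt (f (q w) - r w))\<^sup>2" by simp
    then show "\<exists>s. f (q w) = r w + s\<^sup>2" by blast
  qed auto
  ultimately show "definable_pred N (\<lambda>w. r w \<le> f (q w))" by simp
qed

section \<open>Existence and definability of directional derivatives\<close>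

text \<open>Here the tameness axiom \<open>dimension_one\<close> enters: a definable property of one
  real variable cannot change its truth value infinitely often when approaching \<open>a\<close>
  from the right.\<close>

lemma definable_pred_at_right:
  assumes "definable_pred 1 P"
  shows "(\<forall>\<^sub>F t in at_right a. P (vec1 t)) \<or> (\<forall>\<^sub>F t in at_right a. \<not> P (vec1 t))"
proof -
  obtain F where F: "{v \<in> carrier_vec 1. P v} = vec1 ` (\<Union>F)" "finite F"
    "\<And>I. I \<in> F \<Longrightarrow> is_interval (I :: real set)"
    using assms dimension_one unfolding definable_pred_def by auto
  have "P (vec1 t) \<longleftrightarrow> vec1 t \<in> {v \<in> carrier_vec 1. P v}" for t
    by simp
  then have "P (vec1 t) \<longleftrightarrow> t \<in> \<Union>F" for t
    unfolding F(1) by auto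
  then show ?thesis
    using finite_union_intervals_at_right[OF F(2,3), of a] by simp
qed

lemma dir_deriv_exists_if_definable:
  assumes f: "definable_fun \<O> n f" and lip: "lipschitz_near n L f x"
    and x: "x \<in> carrier_vec n" and l: "l \<in> carrier_vec n"
  shows "dir_deriv_exists f x l"
  unfolding dir_deriv_exists_def has_dir_deriv_def
proof (rule tendsto_if_levels_decided)
  \<comment> \<open>Boundedness is the Lipschitz estimate for difference quotients against the zero
    direction, whose own quotient vanishes.\<close>
  have "l - 0\<^sub>v n = l" "x + t \<cdot>\<^sub>v 0\<^sub>v n = x" for t
    using x l by (auto intro!: eq_vecI)
  then show "\<forall>\<^sub>F t in at_right 0. \<bar>(f (x + t \<cdot>\<^sub>v l) - f x) / t\<bar> \<le> L * vnorm l"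
    using difference_quotient_lipschitz[OF lip x l zero_carrier_vec] by simp
next
  fix c
  \<comment> \<open>The level inequality is multiplied by \<open>t\<close> to make the right-hand
    side polynomial. It describes the sublevel set only for \<open>t > 0\<close>, which is all that
    \<open>at_right 0\<close> sees.\<close>
  have "definable_pred 1 (\<lambda>w. f (x + (w $ 0) \<cdot>\<^sub>v l) \<le> f x + c * w $ 0)"
    using x l
    by (intro definable_pred_fun_le(1)[OF _ f] polynomial_on_intros)
      (auto intro!: polynomial_on_intros)
  then consider "\<forall>\<^sub>F t in at_right 0. f (x + t \<cdot>\<^sub>v l) \<le> f x + c * t"
    | "\<forall>\<^sub>F t in at_right 0. \<not> f (x + t \<cdot>\<^sub>v l) \<le> f x + c * t"
    using definable_pred_at_right[of _ 0] by fastforce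
  then show "(\<forall>\<^sub>F t in at_right 0. c < (f (x + t \<cdot>\<^sub>v l) - f x) / t) \<or>
      (\<forall>\<^sub>F t in at_right 0. (f (x + t \<cdot>\<^sub>v l) - f x) / t \<le> c)"
  proof cases
    case 1
    then have "\<forall>\<^sub>F t in at_right 0. (f (x + t \<cdot>\<^sub>v l) - f x) / t \<le> c"
      using eventually_at_right_less[of "0 :: real"]
      by eventually_elim (simp add: pos_divide_le_eq)
    then show ?thesis ..
  next
    case 2
    then have "\<forall>\<^sub>F t in at_right 0. c < (f (x + t \<cdot>\<^sub>v l) - f x) / t"
      using eventually_at_right_less[of "0 :: real"]
      by eventually_elim (simp add: pos_less_divide_eq)
    then show ?thesis ..
  qed
qed simp

text \<open>The coordinates are \<open>l\<close>, then the candidate value \<open>D\<close>, and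
  then the bound variables \<open>e\<close>, \<open>d\<close> and \<open>t\<close> of
  \<open>has_dir_deriv_iff_ineqs\<close>. The argument \<open>x + t \<cdot>\<^sub>v l\<close> and
  the bounds are polynomial in them.\<close>

lemma definable_pred_has_dir_deriv:
  assumes f: "definable_fun \<O> n f" and x: "x \<in> carrier_vec n"
  shows "definable_pred (Suc n) (\<lambda>w. has_dir_deriv f x (vec_first w n) (w $ n))"
  unfolding has_dir_deriv_iff_ineqs
  using x
  by (intro definable_pred_all definable_pred_imp definable_pred_ex definable_pred_conj
      definable_pred_less definable_pred_fun_le[OF _ f])
    (auto simp: index_vec_first intro!: polynomial_on_intros)

text \<open>The graph is the preimage of the set of pairs of a direction and its derivative under
  the polynomial map that sends \<open>y\<close> and \<open>s\<close> to
  \<open>c + A *\<^sub>v y\<close> and \<open>s\<close>. This covers the functions on which the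
  recursion continues.\<close>

lemma definable_fun_dir_deriv_affine:
  assumes f: "definable_fun \<O> n f" and x: "x \<in> carrier_vec n"
    and ex: "\<And>l. l \<in> carrier_vec n \<Longrightarrow> dir_deriv_exists f x l"
    and c: "c \<in> carrier_vec n" and A: "A \<in> carrier_mat n k" and k: "k \<ge> 1"
  shows "definable_fun \<O> k (\<lambda>y. dir_deriv f x (c + A *\<^sub>v y))"
proof -
  let ?g = "\<lambda>y. dir_deriv f x (c + A *\<^sub>v y)"
  let ?D = "{w \<in> carrier_vec (Suc n). has_dir_deriv f x (vec_first w n) (w $ n)}"
  let ?q = "\<lambda>i w. if i < n then c $ i + (\<Sum>j<k. A $$ (i, j) * w $ j) else w $ k"
  have "?D \<in> \<O> (Suc n)"
    using definable_pred_has_dir_deriv[OF f x] by (simp add: definable_pred_def)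
  moreover have "polynomial_on (Suc k) (?q i)" for i
    by (cases "i < n") (auto intro!: polynomial_on_intros)
  ultimately have "definable_pred (Suc k) (\<lambda>w. vec (Suc n) (\<lambda>i. ?q i w) \<in> ?D)"
    by (intro definable_pred_subst) simp_all
  moreover have "{w \<in> carrier_vec (Suc k). vec (Suc n) (\<lambda>i. ?q i w) \<in> ?D}
      = {y @\<^sub>v vec1 (?g y) | y. y \<in> carrier_vec k}"
  proof -
    \<comment> \<open>Existence of the derivative gives one implication, its uniqueness the
      other.\<close>
    have mem: "vec (Suc n) (\<lambda>i. ?q i w) \<in> ?D \<longleftrightarrow> w $ k = ?g (vec_first w k)"
      if w: "w \<in> carrier_vec (Suc k)" for w
    proof -
      have carrier: "c + A *\<^sub>v vec_first w k \<in> carrier_vec n"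
        using c A by simp
      have "vec_first (vec (Suc n) (\<lambda>i. ?q i w)) n = c + A *\<^sub>v vec_first w k"
        using c A
        by (intro eq_vecI)
          (auto simp: index_vec_first scalar_prod_def atLeast0LessThan intro!: sum.cong)
      then have "vec (Suc n) (\<lambda>i. ?q i w) \<in> ?D \<longleftrightarrow> has_dir_deriv f x (c + A *\<^sub>v vec_first w k) (w $ k)"
        by simp
      also have "\<dots> \<longleftrightarrow> w $ k = ?g (vec_first w k)"
        using ex[OF carrier] dir_deriv_eq unfolding dir_deriv_exists_iff by metis
      finally show ?thesis .
    qed
    have split: "w = vec_first w k @\<^sub>v vec1 (w $ k)" if "w \<in> carrier_vec (Suc k)" for w :: "real vec"
      using that by (intro eq_vecI) (auto simp: vec_first_def vec1_def less_Suc_eq)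
    show ?thesis
    proof (intro equalityI subsetI)
      fix w assume "w \<in> {w \<in> carrier_vec (Suc k). vec (Suc n) (\<lambda>i. ?q i w) \<in> ?D}"
      then have "w \<in> carrier_vec (Suc k)" "w $ k = ?g (vec_first w k)"
        using mem by blast+
      then have "w = vec_first w k @\<^sub>v vec1 (?g (vec_first w k))"
        using split[of w] by simp
      then show "w \<in> {y @\<^sub>v vec1 (?g y) | y. y \<in> carrier_vec k}"
        using vec_first_carrier[of w k] by blast
    next
      fix w assume "w \<in> {y @\<^sub>v vec1 (?g y) | y. y \<in> carrier_vec k}"
      then obtain y where y: "y \<in> carrier_vec k" "w = y @\<^sub>v vec1 (?g y)" by blast
      then have "w \<in> carrier_vec (Suc k)" "w $ k = ?g (vec_first w k)"
        by (simp_all add: append_vec1_carrier append_vec1_index vec_first_append)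
      then show "w \<in> {w \<in> carrier_vec (Suc k). vec (Suc n) (\<lambda>i. ?q i w) \<in> ?D}"
        using mem by blast
    qed
  qed
  ultimately show ?thesis
    unfolding definable_fun_def definable_map_def definable_pred_def by auto
qed

section \<open>Induction on the dimension\<close>

text \<open>Both \<open>f\<close> and \<open>x\<close> vary in the induction, since the hypothesis
  is applied at the origin to a directional derivative along an affine hyperplane. Writing the
  dimension as \<open>Suc k\<close> makes the base case the line.\<close>

lemma M_directed_subdiff_if_definable:
  assumes Rot: "rotation_family Rot"
  shows "definable_fun \<O> (Suc k) f \<Longrightarrow> x \<in> carrier_vec (Suc k) \<Longrightarrow> lipschitz_near (Suc k) L f x
    \<Longrightarrow> 0 \<le> L \<Longrightarrow> M_directed_subdiff Rot L (Suc k) f x"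
proof (induction k arbitrary: f x)
  case 0
  have unit: "vec1 1 \<in> carrier_vec (Suc 0)" "vec1 (-1) \<in> carrier_vec (Suc 0)"
    using vec1_carrier by simp_all
  note ex = unit[THEN dir_deriv_exists_if_definable[OF 0(1,3,2)]]
  show ?case
    using ex dir_deriv_bound[OF 0(3,2) unit(1) ex(1)] dir_deriv_bound[OF 0(3,2) unit(2) ex(2)]
    by (simp add: vnorm_vec1)
next
  case (Suc k)
  let ?n = "Suc (Suc k)"
  have ex: "dir_deriv_exists f x l" if "l \<in> carrier_vec ?n" for l
    using dir_deriv_exists_if_definable[OF Suc.prems(1,3,2) that] .
  have lip: "\<bar>dir_deriv f x l - dir_deriv f x m\<bar> \<le> L * vnorm (l - m)"
    if "l \<in> carrier_vec ?n" "m \<in> carrier_vec ?n" for l m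
    using dir_deriv_lipschitz[OF Suc.prems(3,2) that] ex that by blast
  have "vcontinuous ?n (dir_deriv f x)"
    unfolding vcontinuous_def
  proof (intro ballI allI impI)
    fix l :: "real vec" and \<epsilon> :: real
    assume l: "l \<in> carrier_vec ?n" and "0 < \<epsilon>"
    \<comment> \<open>The denominator is \<open>L + 1\<close> because \<open>L\<close> may be
      zero.\<close>
    have "\<bar>dir_deriv f x m - dir_deriv f x l\<bar> < \<epsilon>"
      if "m \<in> carrier_vec ?n" "vnorm (m - l) < \<epsilon> / (L + 1)" for m
    proof -
      have "\<bar>dir_deriv f x m - dir_deriv f x l\<bar> \<le> L * vnorm (m - l)"
        using lip that l by blast
      also have "\<dots> \<le> (L + 1) * vnorm (m - l)"
        by (simp add: distrib_right vnorm_nonneg)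
      also have "\<dots> < \<epsilon>"
        using that(2) \<open>0 \<le> L\<close> by (simp add: pos_less_divide_eq mult.commute)
      finally show ?thesis .
    qed
    then show "\<exists>\<delta>>0. \<forall>m\<in>carrier_vec ?n. vnorm (m - l) < \<delta> \<longrightarrow>
        \<bar>dir_deriv f x m - dir_deriv f x l\<bar> < \<epsilon>"
      using \<open>0 < \<epsilon>\<close> \<open>0 \<le> L\<close> by (intro exI[of _ "\<epsilon> / (L + 1)"]) simp
  qed
  moreover have "\<bar>dir_deriv f x l\<bar> \<le> L" if "l \<in> unit_sphere ?n" for l
    using dir_deriv_bound[OF Suc.prems(3,2), of l] ex that by (simp add: unit_sphere_def)
  moreover have "M_directed_subdiff Rot L (Suc k)
      (\<lambda>y. dir_deriv f x (l + transpose_mat (Pi_mat Rot ?n l) *\<^sub>v y)) (0\<^sub>v (Suc k))"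
    if "l \<in> unit_sphere ?n" for l
  proof (rule Suc.IH)
    let ?A = "Pi_mat Rot ?n l"
    let ?g = "\<lambda>y. dir_deriv f x (l + transpose_mat ?A *\<^sub>v y)"
    have l: "l \<in> carrier_vec ?n"
      using that by (simp add: unit_sphere_def)
    have "rotation_mat ?n (Rot ?n l)"
      using Rot that unfolding rotation_family_def by simp
    note A = Pi_mat_carrier[of ?n Rot l, OF this, simplified]
      Pi_mat_mult_transpose[of ?n Rot l, OF this, simplified]
    have A': "transpose_mat ?A \<in> carrier_mat ?n (Suc k)"
      using A(1) by simp
    show "definable_fun \<O> (Suc k) ?g"
      by (rule definable_fun_dir_deriv_affine[OF Suc.prems(1,2) ex l A']) simp_all
    \<comment> \<open>The translation by \<open>l\<close> cancels in differences and the linear part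
      preserves norms, so the constant does not grow.\<close>
    have "\<bar>?g y - ?g z\<bar> \<le> L * vnorm (y - z)" if y: "y \<in> carrier_vec (Suc k)" and z: "z \<in> carrier_vec (Suc k)" for y z
    proof -
      have carrier: "transpose_mat ?A *\<^sub>v y \<in> carrier_vec ?n" "transpose_mat ?A *\<^sub>v z \<in> carrier_vec ?n"
        using A' y z by auto
      have "(l + transpose_mat ?A *\<^sub>v y) - (l + transpose_mat ?A *\<^sub>v z)
          = transpose_mat ?A *\<^sub>v y - transpose_mat ?A *\<^sub>v z"
        using l carrier by (intro eq_vecI) auto
      also have "\<dots> = transpose_mat ?A *\<^sub>v (y - z)"
        by (rule mult_minus_distrib_mat_vec[OF A' y z, symmetric])
      finally have "vnorm ((l + transpose_mat ?A *\<^sub>v y) - (l + transpose_mat ?A *\<^sub>v z)) = vnorm (y - z)"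
        using vnorm_transpose_mult[OF A, of "y - z"] y z by simp
      moreover have "\<bar>?g y - ?g z\<bar>
          \<le> L * vnorm ((l + transpose_mat ?A *\<^sub>v y) - (l + transpose_mat ?A *\<^sub>v z))"
        by (rule lip) (use l carrier in auto)
      ultimately show ?thesis by simp
    qed
    \<comment> \<open>The estimate holds for all \<open>y\<close> and \<open>z\<close>, so any
      positive radius will do.\<close>
    then show "lipschitz_near (Suc k) L ?g (0\<^sub>v (Suc k))"
      unfolding lipschitz_near_def by (intro exI[of _ 1]) simp
  qed (use Suc.prems in simp_all)
  ultimately show ?case
    using ex by simp
qed

end

theorem mainTheorem4:
  fixes Rot :: "nat \<Rightarrow> real vec \<Rightarrow> real mat"
    and n :: nat
    and f :: "real vec \<Rightarrow> real"
  assumes "rotation_family Rot"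
    and "n \<ge> 1"
    and "locally_lipschitz n f"
    and "\<exists>\<O>. o_minimal_structure \<O> \<and> definable_fun \<O> n f"
  shows "\<forall>x\<in>carrier_vec n. directed_subdifferentiable Rot n f x"
proof
  fix x :: "real vec" assume x: "x \<in> carrier_vec n"
  obtain k where n: "n = Suc k"
    using assms(2) by (cases n) auto
  obtain \<O> where "o_minimal_structure \<O>" and f: "definable_fun \<O> n f"
    using assms(4) by blast
  then interpret o_minimal_structure \<O> by simp
  obtain L where "0 \<le> L" "lipschitz_near n L f x"
    using assms(3) x unfolding locally_lipschitz_def lipschitz_near_def by meson
  then have "M_directed_subdiff Rot L n f x"
    using M_directed_subdiff_if_definable[OF assms(1), of k f x L] f x n by simp
  then show "directed_subdifferentiable Rot n f x"
    unfolding directed_subdifferentiable_def using \<open>0 \<le> L\<close> by blast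
qed

end
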